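(* The discrete energy $E^m_{\cos}$ is invariant under Möbius transformations: let $m\ge4$, let $p$ be a closed polygon in $\mathbb R^n$ with pairwise different vertices $p(\theta_1),\dots,p(\theta_m)$, let $M$ be a Möbius transformation of $\mathbb R^n\cup\{\infty\}$ with $M(p(\theta_i))\neq\infty$ for all $i$, and let $\hat p$ be the closed polygon with vertices $\hat p(\theta_i)=M(p(\theta_i))$, $i=1,\dots,m$. Then $$E^m_{\cos}(\hat p)=E^m_{\cos}(p).$$
   Context: Möbius transformations of $\mathbb R^n\cup\{\infty\}$ are the compositions of similarities (scalings, translations, orthogonal maps) and inversions in spheres. For a closed polygon $p$ with vertices $p(\theta_1),\dots,p(\theta_m)\in\mathbb R^n$ (indices modulo $m$) write $\Delta_i^jp=p(\theta_j)-p(\theta_i)$, $\Delta_ip=\Delta_i^{i+1}p$, and $d_m(i,j)=\min\{|i-j|,m-|i-j|\}$ for $i,j\in\{1,\dots,m\}$. Let $C_{i,j}$ be the circle (or line, in the collinear case) through $p(\theta_i),p(\theta_{i+1}),p(\theta_j)$, oriented so that these points are passed in this cyclic order. Let $\alpha_{ij}$ be the angle at which $C_{i,j}$ and $C_{j,i}$ meet (at the common point $p(\theta_j)$), and $\tilde\alpha_{ij}$ the angle at which $C_{i,(j+1)}$ and $C_{j,(i+1)}$ meet (at the common point $p(\theta_{i+1})$); that is, the cosine is the inner product of the two oriented unit tangent vectors at the common point. Explicitly, the unit tangent at $c$ of the oriented circle or line through pairwise distinct points $a,b,c$ (in this cyclic order) is $$\frac{\|c-b\|^2(a-c)+\|a-c\|^2(c-b)}{\|a-c\|\,\|b-a\|\,\|c-b\|}.$$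 Then, summing over ordered pairs $(i,j)\in\{1,\dots,m\}^2$, $$E^m_{\cos}(p)=\sum_{d_m(i,j)>1}\frac{\|\Delta_ip\|\,\|\Delta_jp\|}{\|\Delta_i^jp\|\,\|\Delta_{i+1}^{j+1}p\|}\Big(1-\tfrac12\big(\cos\alpha_{ij}+\cos\tilde\alpha_{ij}\big)\Big).$$ *)

theory Defs
  imports "HOL-Analysis.Analysis"
begin

(* The compactification of the Euclidean space 'a by one point: None is the point at infinity. *)
type_synonym 'a compactified = "'a option"

fun sphere_inversion ::
  "'a::euclidean_space \<Rightarrow> real \<Rightarrow> 'a compactified \<Rightarrow> 'a compactified" where
  "sphere_inversion c r None = Some c"
| "sphere_inversion c r (Some x) =
    (if x = c then None else Some (c + (r\<^sup>2 / (norm (x - c))\<^sup>2) *\<^sub>R (x - c)))"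

(* map_option fixes the point at infinity. *)
inductive moebius ::
  "('a::euclidean_space compactified \<Rightarrow> 'a compactified) \<Rightarrow> bool" where
  scaling: "s > 0 \<Longrightarrow> moebius (map_option (\<lambda>x. s *\<^sub>R x))"
| translation: "moebius (map_option (\<lambda>x. x + v))"
| orthogonal: "orthogonal_transformation A \<Longrightarrow> moebius (map_option A)"
| inversion: "r > 0 \<Longrightarrow> moebius (sphere_inversion c r)"
| composition: "moebius f \<Longrightarrow> moebius g \<Longrightarrow> moebius (f \<circ> g)"

(* A closed polygon with m vertices is given by its vertices p 1, ..., p m. Values of p outside
   {1..m} are irrelevant, since the cyclic successor maps {1..m} to itself. *)
definition cyc_suc :: "nat \<Rightarrow> nat \<Rightarrow> nat" where
  "cyc_suc m i = i mod m + 1"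

definition cyc_dist :: "nat \<Rightarrow> nat \<Rightarrow> nat \<Rightarrow> int" where
  "cyc_dist m i j = min \<bar>int i - int j\<bar> (int m - \<bar>int i - int j\<bar>)"

(* Unit tangent at c of the circle (or line) through the pairwise distinct points a, b, c,
   oriented so that they are passed in this cyclic order. *)
definition circle_tangent :: "'a::euclidean_space \<Rightarrow> 'a \<Rightarrow> 'a \<Rightarrow> 'a" where
  "circle_tangent a b c =
    ((norm (c - b))\<^sup>2 *\<^sub>R (a - c) + (norm (a - c))\<^sup>2 *\<^sub>R (c - b))
      /\<^sub>R (norm (a - c) * norm (b - a) * norm (c - b))"

definition unit_angle :: "'a::euclidean_space \<Rightarrow> 'a \<Rightarrow> real" where
  "unit_angle u v = arccos (u \<bullet> v)"

(* C_{i,j} passes p i, p (i+1), p j in this cyclic order; the triples below are rotated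
   cyclically so that the common point of the two circles comes last: p j for alpha, and
   p (i+1) for alpha_tilde, the angle between C_{i,j+1} and C_{j,i+1}. *)
definition alpha :: "nat \<Rightarrow> (nat \<Rightarrow> 'a::euclidean_space) \<Rightarrow> nat \<Rightarrow> nat \<Rightarrow> real" where
  "alpha m p i j =
    unit_angle (circle_tangent (p i) (p (cyc_suc m i)) (p j))
               (circle_tangent (p (cyc_suc m j)) (p i) (p j))"

definition alpha_tilde :: "nat \<Rightarrow> (nat \<Rightarrow> 'a::euclidean_space) \<Rightarrow> nat \<Rightarrow> nat \<Rightarrow> real" where
  "alpha_tilde m p i j =
    unit_angle (circle_tangent (p (cyc_suc m j)) (p i) (p (cyc_suc m i)))
               (circle_tangent (p j) (p (cyc_suc m j)) (p (cyc_suc m i)))"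

definition E_cos :: "nat \<Rightarrow> (nat \<Rightarrow> 'a::euclidean_space) \<Rightarrow> real" where
  "E_cos m p =
    (\<Sum>(i, j) \<in> {(i, j) \<in> {1..m} \<times> {1..m}. cyc_dist m i j > 1}.
      (norm (p (cyc_suc m i) - p i) * norm (p (cyc_suc m j) - p j))
        / (norm (p j - p i) * norm (p (cyc_suc m j) - p (cyc_suc m i)))
        * (1 - 1 / 2 * (cos (alpha m p i j) + cos (alpha_tilde m p i j))))"

end

theory Submission
  imports Defs
begin

text \<open>
  A Moebius transformation \<open>M\<close> distorts distances multiplicatively: there is a positive weight
  \<open>w\<close> with \<open>\<parallel>M x - M y\<parallel> = w x * w y * \<parallel>x - y\<parallel>\<close>. For an inversion with centre \<open>c\<close> and radius
  \<open>r\<close> one has \<open>w x = r / \<parallel>x - c\<parallel>\<close>. Hence everything that is a function of distances and homogeneous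
  of degree \<open>0\<close> in each of the points separately is invariant. The factor
  \<open>\<parallel>\<Delta>\<^sub>i p\<parallel> \<parallel>\<Delta>\<^sub>j p\<parallel> / (\<parallel>\<Delta>\<^sub>i\<^sup>j p\<parallel> \<parallel>\<Delta>\<^sub>i\<^sub>+\<^sub>1\<^sup>j\<^sup>+\<^sup>1 p\<parallel>)\<close> is plainly of this kind, being a cross ratio, and
  the lemma \<open>inner_circle_tangent\<close> shows by polarization that the cosine of the angle between two
  circles through a common point is so as well. The energy is thus invariant summand by summand.

  A composition may send a vertex to infinity and back, so the distortion law cannot be proved by
  induction on \<open>M\<close> for finite points alone. It is therefore stated on the whole compactification
  (lemma \<open>moebius_distortion\<close>), for an extension of the distance to the point at infinity.
\<close>

section \<open>Distortion of distances by Moebius transformations\<close>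

text \<open>
  The value \<open>1\<close> at infinity is the limit of \<open>\<parallel>x - y\<parallel> / \<parallel>y\<parallel>\<close> for \<open>y\<close> tending to infinity. This is
  not a metric: only its behaviour up to rescaling at each point matters.
\<close>

fun ext_dist :: "'a::euclidean_space compactified \<Rightarrow> 'a compactified \<Rightarrow> real" where
  "ext_dist (Some x) (Some y) = norm (x - y)"
| "ext_dist (Some x) None = 1"
| "ext_dist None (Some y) = 1"
| "ext_dist None None = 0"

lemma norm_diff_inversion:
  fixes u v :: "'a::euclidean_space"
  assumes "u \<noteq> 0" "v \<noteq> 0"
  shows "norm ((k / (norm u)\<^sup>2) *\<^sub>R u - (k / (norm v)\<^sup>2) *\<^sub>R v)
    = \<bar>k\<bar> * norm (u - v) / (norm u * norm v)"
proof (rule power2_eq_imp_eq)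
  have nz: "norm u \<noteq> 0" "norm v \<noteq> 0"
    using assms by auto
  have sq: "(norm (x - y))\<^sup>2 = (norm x)\<^sup>2 + (norm y)\<^sup>2 - 2 * (x \<bullet> y)" for x y :: 'a
    by (simp add: power2_norm_eq_inner inner_diff_left inner_diff_right inner_commute)
  have frac: "(\<bar>k / x\<^sup>2\<bar> * x)\<^sup>2 + (\<bar>k / y\<^sup>2\<bar> * y)\<^sup>2 - 2 * (k / y\<^sup>2 * (k / x\<^sup>2 * t))
      = k\<^sup>2 * (x\<^sup>2 + y\<^sup>2 - 2 * t) / (x\<^sup>2 * y\<^sup>2)" if "x \<noteq> 0" "y \<noteq> 0" for x y t :: real
    using that by (simp add: power_mult_distrib power_divide) (simp add: field_simps power2_eq_square power4_eq_xxxx)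
  show "(norm ((k / (norm u)\<^sup>2) *\<^sub>R u - (k / (norm v)\<^sup>2) *\<^sub>R v))\<^sup>2
      = (\<bar>k\<bar> * norm (u - v) / (norm u * norm v))\<^sup>2"
    unfolding sq norm_scaleR inner_scaleR_left inner_scaleR_right frac[OF nz]
    by (simp add: power_mult_distrib power_divide sq)
qed auto

lemma sphere_inversion_distortion:
  assumes "r > 0"
  shows "\<exists>w. (\<forall>x. w x > 0) \<and>
    (\<forall>x y. ext_dist (sphere_inversion c r x) (sphere_inversion c r y) = w x * w y * ext_dist x y)"
proof -
  \<comment> \<open>The values at infinity and at the centre are forced by pairing these with a generic point.\<close>
  define w where "w z = (case z of None \<Rightarrow> r
    | Some x \<Rightarrow> if x = c then 1 / r else r / norm (x - c))" for z
  have "ext_dist (sphere_inversion c r x) (sphere_inversion c r y) = w x * w y * ext_dist x y" for x y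
  proof (cases x; cases y)
    fix a b assume "x = Some a" "y = Some b"
    then show ?thesis
      using assms norm_diff_inversion[of "a - c" "b - c" "r\<^sup>2"]
      by (auto simp: w_def norm_minus_commute power2_eq_square)
  qed (use assms in \<open>auto simp: w_def power2_eq_square\<close>)
  moreover have "w z > 0" for z
    using assms by (auto simp: w_def split: option.split)
  ultimately show ?thesis
    by blast
qed

lemma similarity_distortion:
  fixes f :: "'a::euclidean_space \<Rightarrow> 'a"
  assumes "s > 0" and f: "\<And>x y. norm (f x - f y) = s * norm (x - y)"
  shows "\<exists>w. (\<forall>x. w x > 0) \<and>
    (\<forall>x y. ext_dist (map_option f x) (map_option f y) = w x * w y * ext_dist x y)"
proof -
  define w :: "'a compactified \<Rightarrow> real"
    where "w z = (case z of None \<Rightarrow> 1 / sqrt s | Some x \<Rightarrow> sqrt s)" for z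
  have "ext_dist (map_option f x) (map_option f y) = w x * w y * ext_dist x y" for x y
    using assms by (cases x; cases y) (auto simp: w_def f)
  moreover have "w z > 0" for z
    using assms by (auto simp: w_def split: option.split)
  ultimately show ?thesis
    by blast
qed

theorem moebius_distortion:
  assumes "moebius M"
  shows "\<exists>w. (\<forall>x. w x > 0) \<and> (\<forall>x y. ext_dist (M x) (M y) = w x * w y * ext_dist x y)"
  using assms
proof induction
  case (scaling s)
  then show ?case
    by (intro similarity_distortion[of s]) (auto simp flip: scaleR_diff_right)
next
  case (translation v)
  show ?case
    by (intro similarity_distortion[of 1]) auto
next
  case (orthogonal A)
  then have "norm (A x - A y) = 1 * norm (x - y)" for x y
    by (metis linear_diff mult_1 orthogonal_transformation)
  then show ?case
    by (intro similarity_distortion[of 1]) auto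
next
  case (inversion r c)
  then show ?case
    by (rule sphere_inversion_distortion)
next
  case (composition f g)
  then obtain u v where
    u: "\<And>x. u x > 0" "\<And>x y. ext_dist (f x) (f y) = u x * u y * ext_dist x y" and
    v: "\<And>x. v x > 0" "\<And>x y. ext_dist (g x) (g y) = v x * v y * ext_dist x y"
    by metis
  show ?case
    by (rule exI[of _ "\<lambda>x. u (g x) * v x"]) (simp add: u v)
qed

section \<open>Angles between circles in terms of distances\<close>

text \<open>
  Polarization turns each of the four inner products of the vectors from \<open>c\<close> into squared
  distances. The terms without a factor \<open>\<parallel>a - a'\<parallel>\<close>, \<open>\<parallel>b - b'\<parallel>\<close>, \<open>\<parallel>a - b'\<parallel>\<close> or \<open>\<parallel>b - a'\<parallel>\<close> cancel,
  which is what makes the numerator homogeneous in each point. Since division by \<open>0\<close> gives \<open>0\<close>,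
  the identity also holds for coinciding points.
\<close>

lemma inner_circle_tangent:
  fixes a b a' b' c :: "'a::euclidean_space"
  shows "circle_tangent a b c \<bullet> circle_tangent a' b' c =
    ((norm (b - c) * norm (a' - c) * norm (a - b'))\<^sup>2 + (norm (a - c) * norm (b' - c) * norm (b - a'))\<^sup>2
      - (norm (b - c) * norm (b' - c) * norm (a - a'))\<^sup>2 - (norm (a - c) * norm (a' - c) * norm (b - b'))\<^sup>2)
    / (2 * (norm (a - c) * norm (a - b) * norm (b - c)) * (norm (a' - c) * norm (a' - b') * norm (b' - c)))"
proof -
  define u v u' v' where d: "u = a - c" "v = b - c" "u' = a' - c" "v' = b' - c"
  have diff: "a - b' = u - v'" "b - a' = v - u'" "a - a' = u - u'" "b - b' = v - v'"
    by (simp_all add: d)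
  have sq: "(norm (x - y))\<^sup>2 = (norm x)\<^sup>2 + (norm y)\<^sup>2 - 2 * (x \<bullet> y)" for x y :: 'a
    by (simp add: power2_norm_eq_inner inner_diff_left inner_diff_right inner_commute)
  have tangent: "circle_tangent x y c =
      ((norm (y - c))\<^sup>2 *\<^sub>R (x - c) - (norm (x - c))\<^sup>2 *\<^sub>R (y - c))
        /\<^sub>R (norm (x - c) * norm (x - y) * norm (y - c))" for x y
    by (simp add: circle_tangent_def norm_minus_commute algebra_simps)
  have scale: "(x /\<^sub>R d) \<bullet> (y /\<^sub>R e) = 2 * (x \<bullet> y) / (2 * d * e)" for x y :: 'a and d e
    by (simp add: field_simps)
  have "2 * (((norm v)\<^sup>2 *\<^sub>R u - (norm u)\<^sup>2 *\<^sub>R v) \<bullet> ((norm v')\<^sup>2 *\<^sub>R u' - (norm u')\<^sup>2 *\<^sub>R v')) =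
      (norm v * norm u' * norm (u - v'))\<^sup>2 + (norm u * norm v' * norm (v - u'))\<^sup>2
      - (norm v * norm v' * norm (u - u'))\<^sup>2 - (norm u * norm u' * norm (v - v'))\<^sup>2"
    unfolding power_mult_distrib sq
    by (simp add: algebra_simps)
  then show ?thesis
    unfolding tangent scale diff d(1-4)[symmetric] by simp
qed

text \<open>Each point contributes its weight equally often to the numerator and to the denominator.\<close>

lemma inner_circle_tangent_invariant:
  fixes p q :: "'i \<Rightarrow> 'a::euclidean_space"
  assumes pos: "\<And>i. i \<in> I \<Longrightarrow> w i > 0"
    and q: "\<And>i j. i \<in> I \<Longrightarrow> j \<in> I \<Longrightarrow> norm (q i - q j) = w i * w j * norm (p i - p j)"
    and I: "i \<in> I" "j \<in> I" "i' \<in> I" "j' \<in> I" "k \<in> I"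
  shows "circle_tangent (q i) (q j) (q k) \<bullet> circle_tangent (q i') (q j') (q k) =
    circle_tangent (p i) (p j) (p k) \<bullet> circle_tangent (p i') (p j') (p k)"
proof -
  define K where "K = (w i * w j * w i' * w j' * (w k)\<^sup>2)\<^sup>2"
  have K: "K \<noteq> 0"
    using pos[OF I(1)] pos[OF I(2)] pos[OF I(3)] pos[OF I(4)] pos[OF I(5)] by (simp add: K_def)
  have cancel: "x = K * x' \<Longrightarrow> y = K * y' \<Longrightarrow> x / y = x' / y'" for x y x' y' :: real
    using K by simp
  show ?thesis
    unfolding inner_circle_tangent
    by (rule cancel; simp only: q I K_def power_mult_distrib right_diff_distrib distrib_left)
      (simp_all add: power2_eq_square mult_ac)
qed

section \<open>Invariance of the energy\<close>

lemma cyc_suc_in_range: "i \<in> {1..m} \<Longrightarrow> cyc_suc m i \<in> {1..m}"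
  by (simp add: cyc_suc_def Suc_leI)

lemma E_cos_invariant:
  fixes p q :: "nat \<Rightarrow> 'a::euclidean_space"
  assumes pos: "\<And>i. i \<in> {1..m} \<Longrightarrow> w i > 0"
    and q: "\<And>i j. i \<in> {1..m} \<Longrightarrow> j \<in> {1..m} \<Longrightarrow> norm (q i - q j) = w i * w j * norm (p i - p j)"
  shows "E_cos m q = E_cos m p"
proof -
  have "norm (q (cyc_suc m i) - q i) * norm (q (cyc_suc m j) - q j)
        / (norm (q j - q i) * norm (q (cyc_suc m j) - q (cyc_suc m i)))
        * (1 - 1 / 2 * (cos (alpha m q i j) + cos (alpha_tilde m q i j))) =
      norm (p (cyc_suc m i) - p i) * norm (p (cyc_suc m j) - p j)
        / (norm (p j - p i) * norm (p (cyc_suc m j) - p (cyc_suc m i)))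
        * (1 - 1 / 2 * (cos (alpha m p i j) + cos (alpha_tilde m p i j)))"
    if ij: "i \<in> {1..m}" "j \<in> {1..m}" for i j
  proof -
    note I = ij ij[THEN cyc_suc_in_range]
    note tangents = inner_circle_tangent_invariant[where I = "{1..m}", OF pos q]
    have "alpha m q i j = alpha m p i j"
      unfolding alpha_def unit_angle_def by (subst tangents) (use I in auto)
    moreover have "alpha_tilde m q i j = alpha_tilde m p i j"
      unfolding alpha_tilde_def unit_angle_def by (subst tangents) (use I in auto)
    moreover have "norm (q (cyc_suc m i) - q i) * norm (q (cyc_suc m j) - q j)
        / (norm (q j - q i) * norm (q (cyc_suc m j) - q (cyc_suc m i))) =
      norm (p (cyc_suc m i) - p i) * norm (p (cyc_suc m j) - p j)
        / (norm (p j - p i) * norm (p (cyc_suc m j) - p (cyc_suc m i)))"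
      unfolding q[OF I(3) I(1)] q[OF I(4) I(2)] q[OF I(2) I(1)] q[OF I(4) I(3)]
      using pos[OF I(1)] pos[OF I(2)] pos[OF I(3)] pos[OF I(4)]
      by (simp add: field_simps)
    ultimately show ?thesis
      by simp
  qed
  then show ?thesis
    unfolding E_cos_def by (intro sum.cong) auto
qed

theorem mainTheorem2:
  fixes m :: nat
    and p p_hat :: "nat \<Rightarrow> real ^ 'n"
    and M :: "(real ^ 'n) compactified \<Rightarrow> (real ^ 'n) compactified"
  assumes "m \<ge> 4"
    and "inj_on p {1..m}"
    and "moebius M"
    and "\<forall>i\<in>{1..m}. M (Some (p i)) \<noteq> None"
    and "\<forall>i\<in>{1..m}. M (Some (p i)) = Some (p_hat i)"
  shows "E_cos m p_hat = E_cos m p"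
proof -
  obtain w where w: "\<And>x. w x > 0" "\<And>x y. ext_dist (M x) (M y) = w x * w y * ext_dist x y"
    using moebius_distortion[OF assms(3)] by blast
  show ?thesis
  proof (rule E_cos_invariant[where w = "\<lambda>i. w (Some (p i))"])
    fix i j assume "i \<in> {1..m}" "j \<in> {1..m}"
    then show "norm (p_hat i - p_hat j) = w (Some (p i)) * w (Some (p j)) * norm (p i - p j)"
      using w(2)[of "Some (p i)" "Some (p j)"] assms(5) by simp
  qed (rule w)
qed

end
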